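(* Let $A=\{0,1\}$, let $A^{*}$ be the set of finite words over $A$, viewed as the binary rooted tree, and let $a,b,c,d\in \mathrm{Aut}(A^{*})$ be the automorphisms defined recursively, for all $w\in A^{*}$, by $$a(0w)=1\,d(w),\quad a(1w)=0\,w,\qquad b(0w)=0\,a(w),\quad b(1w)=1\,c(w),$$ $$c(0w)=0\,a(w),\quad c(1w)=1\,a(w),\qquad d(0w)=0\,w,\quad d(1w)=1\,b(w)$$ (that is, by the wreath recursion $a=\sigma(d,1)$, $b=(a,c)$, $c=(a,a)$, $d=(1,b)$). Let $\Pi$ be the automaton with states $\{1,a,b,c,d\}$ over the alphabet $A$ given by this recursion, and let $G=\langle a,b,c,d\rangle\le \mathrm{Aut}(A^{*})$ be the self-similar group it generates. Then: 1. The action of $G$ on $A^{*}$ is contracting, i.e. there exists a minimal finite non-empty set $\mathcal{N}\subset G$ (the nucleus) such that for every $g\in G$ there is $k\in\mathbb{N}$ with $g|_{v}\in\mathcal{N}$ for all words $v\in A^{*}$ of length at least $k$. 2. $G$ is a fractal group, i.e. $G$ is self-replicating and acts transitively on every level $A^{n}$, $n\ge 1$, of the tree. 3. The action satisfies the open set condition. 4. The automaton $\Pi$ has exponential growth of activity. 5. $G$ is a weakly branch group.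
   Context: Restrictions: for $g\in \mathrm{Aut}(A^{*})$ and $v\in A^{*}$, the restriction $g|_{v}\in\mathrm{Aut}(A^{*})$ is the unique automorphism with $g(vw)=g(v)\,g|_{v}(w)$ for all $w\in A^{*}$. A group $G\le\mathrm{Aut}(A^{*})$ is self-similar if $g|_{x}\in G$ for all $g\in G$ and $x\in A$. Here $1$ denotes the identity automorphism, and it is also the trivial state of the automaton. In the wreath recursion, $g=\sigma(g_0,g_1)$ (respectively $g=(g_0,g_1)$) means that $g|_0=g_0$, $g|_1=g_1$ and $g$ swaps (respectively fixes) the letters $0$ and $1$ on the first level. Contracting and nucleus: a self-similar group $G$ is contracting if there is a finite set $\mathcal{N}\subset G$ such that for every $g\in G$ there is $k\in\mathbb{N}$ with $g|_{v}\in\mathcal{N}$ for all $v\in A^{*}$ of length at least $k$. The minimal such set is unique and is called the nucleus. Self-replicating: a self-similar group $G$ is self-replicating if it is transitive on the first level $A$ and, for some (equivalently every) letter $x\in A$, the map $\mathrm{St}_G(1)\to G$, $g\mapsto g|_{x}$, is surjective, where $\mathrm{St}_G(1)$ is the subgroup of elements of $G$ fixing every vertex of the first level. Open set condition: a contracting action satisfies the open set condition if every element of its nucleus has a trivial restriction; equivalently, for every $g\in G$ there is $v\in A^{*}$ with $g|_{v}=1$. Activity growth: for a state $q$ of $\Pi$, its activity at level $n$ is $\#\{v\in A^{n} : q|_{v}\neq 1\}$. The automaton has exponential growth of activity if for some state $q$ this number grows exponentially in $n$. Weakly branch: for a vertex $v\in A^{*}$, the rigid stabilizer $\mathrm{RiSt}_G(v)$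 is the subgroup of elements of $G$ that fix every word not having $v$ as a prefix; $\mathrm{RiSt}_G(n)$ is the subgroup generated by all $\mathrm{RiSt}_G(v)$ with $v\in A^{n}$. A level-transitive group $G\le \mathrm{Aut}(A^{*})$ (i.e. transitive on every $A^n$) is weakly branch if $\mathrm{RiSt}_G(n)$ is infinite (equivalently, non-trivial) for every $n\ge 1$. *)

theory Defs
  imports Complex_Main "HOL-Library.Sublist" "HOL-Algebra.Generated_Groups"
begin

section \<open>Automorphisms of the rooted tree of finite words\<close>

definition tree_aut :: "('x list \<Rightarrow> 'x list) set" where
  "tree_aut = {g. bij g \<and> (\<forall>v. length (g v) = length v) \<and>
                  (\<forall>v w. prefix v w \<longrightarrow> prefix (g v) (g w))}"

definition Aut :: "('x list \<Rightarrow> 'x list) monoid" where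
  "Aut = \<lparr>carrier = tree_aut, mult = (\<circ>), one = id\<rparr>"

text \<open>\<open>restriction g v\<close> is $g|_v$; the lemmas after the definition show that, for a tree automorphism,
  it is the unique automorphism with $g(vw) = g(v)\,g|_v(w)$.\<close>

definition restriction :: "('x list \<Rightarrow> 'x list) \<Rightarrow> 'x list \<Rightarrow> 'x list \<Rightarrow> 'x list" where
  "restriction g v w = drop (length v) (g (v @ w))"

lemma restriction_append:
  assumes "g \<in> tree_aut"
  shows "g (v @ w) = g v @ restriction g v w"
proof -
  have "prefix (g v) (g (v @ w))" "length (g v) = length v"
    using assms by (auto simp: tree_aut_def)
  then show ?thesis
    by (auto simp: restriction_def prefix_def)
qed

lemma restriction_unique:
  assumes "g \<in> tree_aut" "\<And>w. g (v @ w) = g v @ h w"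
  shows "h = restriction g v"
  using restriction_append[OF assms(1)] assms(2) by auto

lemma restriction_in_tree_aut:
  assumes g: "g \<in> tree_aut"
  shows "restriction g v \<in> tree_aut"
proof -
  let ?h = "restriction g v"
  have inj: "g x = g y \<Longrightarrow> x = y" for x y
    using g by (auto simp: tree_aut_def bij_def dest: injD)
  have len: "length (g x) = length x" for x
    using g by (auto simp: tree_aut_def)
  have pre: "prefix x y \<Longrightarrow> prefix (g x) (g y)" for x y
    using g by (auto simp: tree_aut_def)
  have app: "g (v @ w) = g v @ ?h w" for w
    by (rule restriction_append[OF g])
  have "inj ?h"
    by (rule injI) (metis app inj same_append_eq)
  moreover have "\<exists>w. ?h w = u" for u
  proof -
    have "surj g"
      using g by (simp add: tree_aut_def bij_def)
    then obtain z where z: "g z = g v @ u"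
      by (metis surjD)
    have lz: "length v \<le> length z"
      using arg_cong[OF z, of length] by (simp add: len)
    have "prefix (g (take (length v) z)) (g v @ u)"
      using pre[OF take_is_prefix[of "length v" z]] z by simp
    moreover have "length (g (take (length v) z)) = length (g v)"
      using lz by (simp add: len)
    ultimately have "g (take (length v) z) = g v"
      by (auto simp: prefix_def append_eq_append_conv)
    then have "take (length v) z = v"
      by (rule inj)
    then have "z = v @ drop (length v) z"
      using append_take_drop_id[of "length v" z] by simp
    then have "g v @ ?h (drop (length v) z) = g v @ u"
      using z app[of "drop (length v) z"] by simp
    then show ?thesis
      by auto
  qed
  ultimately have "bij ?h"
    unfolding bij_def surj_def by metis
  moreover have "length (?h w) = length w" for w
    using len[of "v @ w"] by (simp add: restriction_def)
  moreover have "prefix (?h x) (?h y)" if "prefix x y" for x y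
    using pre[of "v @ x" "v @ y"] that by (simp add: app)
  ultimately show ?thesis
    by (simp add: tree_aut_def)
qed


section \<open>Properties of groups acting on the tree\<close>

definition self_similar :: "('x list \<Rightarrow> 'x list) set \<Rightarrow> bool" where
  "self_similar G \<longleftrightarrow> subgroup G Aut \<and> (\<forall>g\<in>G. \<forall>x. restriction g [x] \<in> G)"

definition absorbing :: "('x list \<Rightarrow> 'x list) set \<Rightarrow> ('x list \<Rightarrow> 'x list) set \<Rightarrow> bool" where
  "absorbing G N \<longleftrightarrow> finite N \<and> N \<subseteq> G \<and>
     (\<forall>g\<in>G. \<exists>k. \<forall>v. length v \<ge> k \<longrightarrow> restriction g v \<in> N)"

definition contracting :: "('x list \<Rightarrow> 'x list) set \<Rightarrow> bool" where
  "contracting G \<longleftrightarrow> self_similar G \<and> (\<exists>N. absorbing G N)"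

definition is_nucleus :: "('x list \<Rightarrow> 'x list) set \<Rightarrow> ('x list \<Rightarrow> 'x list) set \<Rightarrow> bool" where
  "is_nucleus G N \<longleftrightarrow> absorbing G N \<and> (\<forall>M. absorbing G M \<and> M \<subseteq> N \<longrightarrow> M = N)"

lemma absorbing_Int:
  assumes "absorbing G M" "absorbing G N"
  shows "absorbing G (M \<inter> N)"
  unfolding absorbing_def
proof (intro conjI ballI)
  fix g assume "g \<in> G"
  then obtain k l where "\<forall>v. length v \<ge> k \<longrightarrow> restriction g v \<in> M"
    and "\<forall>v. length v \<ge> l \<longrightarrow> restriction g v \<in> N"
    using assms unfolding absorbing_def by meson
  then have "\<forall>v. length v \<ge> max k l \<longrightarrow> restriction g v \<in> M \<inter> N"
    by auto
  then show "\<exists>k. \<forall>v. length v \<ge> k \<longrightarrow> restriction g v \<in> M \<inter> N" ..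
qed (use assms in \<open>auto simp: absorbing_def\<close>)

lemma contracting_ex1_nucleus:
  assumes "contracting G"
  shows "\<exists>!N. is_nucleus G N"
proof -
  obtain N0 where "absorbing G N0"
    using assms by (auto simp: contracting_def)
  then obtain N where N: "absorbing G N" and min: "\<And>M. absorbing G M \<Longrightarrow> card N \<le> card M"
    using ex_has_least_nat[of "absorbing G" N0 card] by blast
  have "finite N"
    using N by (simp add: absorbing_def)
  then have "is_nucleus G N"
    using N min by (simp add: is_nucleus_def card_seteq)
  moreover have "M = M'" if "is_nucleus G M" "is_nucleus G M'" for M M'
  proof -
    have "absorbing G (M \<inter> M')"
      using that by (intro absorbing_Int) (simp_all add: is_nucleus_def)
    then have "M \<inter> M' = M" "M \<inter> M' = M'"
      using that unfolding is_nucleus_def by (meson inf_le1, meson inf_le2)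
    then show ?thesis by simp
  qed
  ultimately show ?thesis by blast
qed

definition open_set_condition :: "('x list \<Rightarrow> 'x list) set \<Rightarrow> bool" where
  "open_set_condition G \<longleftrightarrow> contracting G \<and>
     (\<exists>N. is_nucleus G N \<and> (\<forall>g\<in>N. \<exists>v. restriction g v = id))"

definition level_transitive :: "('x list \<Rightarrow> 'x list) set \<Rightarrow> bool" where
  "level_transitive G \<longleftrightarrow> (\<forall>n. \<forall>v w. length v = n \<and> length w = n \<longrightarrow> (\<exists>g\<in>G. g v = w))"

definition level1_stabilizer :: "('x list \<Rightarrow> 'x list) set \<Rightarrow> ('x list \<Rightarrow> 'x list) set" where
  "level1_stabilizer G = {g \<in> G. \<forall>x. g [x] = [x]}"

definition self_replicating :: "('x list \<Rightarrow> 'x list) set \<Rightarrow> bool" where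
  "self_replicating G \<longleftrightarrow> self_similar G \<and>
     (\<forall>x y. \<exists>g\<in>G. g [x] = [y]) \<and>
     (\<forall>x. (\<lambda>g. restriction g [x]) ` level1_stabilizer G = G)"

definition fractal :: "('x list \<Rightarrow> 'x list) set \<Rightarrow> bool" where
  "fractal G \<longleftrightarrow> self_replicating G \<and> level_transitive G"

definition rigid_stabilizer :: "('x list \<Rightarrow> 'x list) set \<Rightarrow> 'x list \<Rightarrow> ('x list \<Rightarrow> 'x list) set" where
  "rigid_stabilizer G v = {g \<in> G. \<forall>w. \<not> prefix v w \<longrightarrow> g w = w}"

definition rigid_level_stabilizer :: "('x list \<Rightarrow> 'x list) set \<Rightarrow> nat \<Rightarrow> ('x list \<Rightarrow> 'x list) set" where
  "rigid_level_stabilizer G n = generate Aut (\<Union>v\<in>{v. length v = n}. rigid_stabilizer G v)"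

definition weakly_branch :: "('x list \<Rightarrow> 'x list) set \<Rightarrow> bool" where
  "weakly_branch G \<longleftrightarrow> subgroup G Aut \<and> level_transitive G \<and>
     (\<forall>n\<ge>1. infinite (rigid_level_stabilizer G n))"


section \<open>Automata and growth of activity\<close>

record ('q, 'x) automaton =
  next_state :: "'q \<Rightarrow> 'x \<Rightarrow> 'q"
  output_letter :: "'q \<Rightarrow> 'x \<Rightarrow> 'x"

primrec act :: "('q, 'x) automaton \<Rightarrow> 'q \<Rightarrow> 'x list \<Rightarrow> 'x list" where
  "act M q [] = []"
| "act M q (x # w) = output_letter M q x # act M (next_state M q x) w"

definition activity :: "('q, 'x) automaton \<Rightarrow> 'q \<Rightarrow> nat \<Rightarrow> nat" where
  "activity M q n = card {v. length v = n \<and> restriction (act M q) v \<noteq> id}"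

text \<open>Only a lower bound is required: over a finite alphabet the activity at level \<open>n\<close>
  is at most the number of words of length \<open>n\<close>, hence at most exponential.\<close>

definition exponential_activity :: "('q, 'x::finite) automaton \<Rightarrow> bool" where
  "exponential_activity M \<longleftrightarrow>
     (\<exists>q. \<exists>C>0. \<exists>r>1. \<forall>n. real (activity M q n) \<ge> C * r ^ n)"


section \<open>The automaton and its group\<close>

text \<open>The letters 0 and 1 are encoded as \<open>False\<close> and \<open>True\<close>.\<close>

datatype state = S1 | Sa | Sb | Sc | Sd

fun pi_next :: "state \<Rightarrow> bool \<Rightarrow> state" where
  "pi_next S1 _ = S1"
| "pi_next Sa False = Sd" | "pi_next Sa True = S1"
| "pi_next Sb False = Sa" | "pi_next Sb True = Sc"
| "pi_next Sc False = Sa" | "pi_next Sc True = Sa"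
| "pi_next Sd False = S1" | "pi_next Sd True = Sb"

fun pi_output :: "state \<Rightarrow> bool \<Rightarrow> bool" where
  "pi_output Sa x = (\<not> x)"
| "pi_output _ x = x"

definition Pi_automaton :: "(state, bool) automaton" where
  "Pi_automaton = \<lparr>next_state = pi_next, output_letter = pi_output\<rparr>"

definition aut_a :: "bool list \<Rightarrow> bool list" where "aut_a = act Pi_automaton Sa"
definition aut_b :: "bool list \<Rightarrow> bool list" where "aut_b = act Pi_automaton Sb"
definition aut_c :: "bool list \<Rightarrow> bool list" where "aut_c = act Pi_automaton Sc"
definition aut_d :: "bool list \<Rightarrow> bool list" where "aut_d = act Pi_automaton Sd"

lemma act_S1: "act Pi_automaton S1 = id"
proof
  fix w show "act Pi_automaton S1 w = id w"
    by (induction w) (simp_all add: Pi_automaton_def)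
qed

lemma aut_recursion:
  "aut_a (False # w) = True # aut_d w"   "aut_a (True # w) = False # w"
  "aut_b (False # w) = False # aut_a w"  "aut_b (True # w) = True # aut_c w"
  "aut_c (False # w) = False # aut_a w"  "aut_c (True # w) = True # aut_a w"
  "aut_d (False # w) = False # w"        "aut_d (True # w) = True # aut_b w"
proof -
  have step: "act Pi_automaton q (x # w) = pi_output q x # act Pi_automaton (pi_next q x) w" for q x w
    by (simp add: Pi_automaton_def)
  show "aut_a (False # w) = True # aut_d w"   "aut_a (True # w) = False # w"
    "aut_b (False # w) = False # aut_a w"  "aut_b (True # w) = True # aut_c w"
    "aut_c (False # w) = False # aut_a w"  "aut_c (True # w) = True # aut_a w"
    "aut_d (False # w) = False # w"        "aut_d (True # w) = True # aut_b w"
    by (simp_all only: aut_a_def aut_b_def aut_c_def aut_d_def step act_S1 id_apply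
        pi_next.simps pi_output.simps not_False_eq_True not_True_eq_False)
qed

definition Pi_group :: "(bool list \<Rightarrow> bool list) set" where
  "Pi_group = generate Aut {aut_a, aut_b, aut_c, aut_d}"

end

theory Submission
  imports Defs
begin

text \<open>
  Contraction. Write $P = \{1, a, b, c, d, ac, cb, bd, da\}$. The wreath recursion gives
  $ac = \sigma(da, a)$, $cb = (a^2, ac)$, $bd = (a, cb)$, $da = \sigma(bd, 1)$ and
  $a^2 = (d, d)$, so $P$ together with $a^2$ is closed under restriction. Since
  $(u^{-1}v)|_x = (u|_y)^{-1}\,v|_x$ whenever $u(y) = v(x)$, the finite set of all quotients
  $u^{-1}v$ with $u, v \in P$, enlarged by $a^2$ and $a^{-2}$, is closed under restriction
  too: where $cb$ contributes $a^2$, the other factor contributes only $1$, $a$ or $a^2$. If $n$ lies in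
  this set and $s$ is a generator or an inverse of one, all restrictions of $sn$ to words of length
  seven lie in the set again. By induction on the length of a product, every element of the
  group is eventually absorbed. Only free cancellation of words is involved, so this is a finite
  computation on words (\<open>letter_times_quotient_within\<close>). The same words show that each of these
  quotients has a trivial restriction, which is the open set condition.

  Self-replication. Both letters are fixed by $b$, $c$, $d$, $a^2$ and the conjugates of $b$ and $d$ by
  $a$. Their restrictions to a given letter include all four generators. Transitivity on all levels follows
  from transitivity on letters, since elements fixing the first level can be prescribed below any letter.

  Weak branching. The element $d = (1, b)$ puts a copy of every conjugate of $b$ below the vertex $1$.
  An element $x$ commuting with all conjugates of $b$ is trivial: it must fix the first level, because
  $[b, d]$ is non-trivial and acts below the vertex $1$ only; and as $b = (a, c)$, both of its restrictions
  commute with all conjugates of $a$. The same step leads from $a$ to $d$ through $a^2 = (d, d)$ and from $d$ back to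
  $b$, so $x$ fixes every word letter by letter (\<open>trivial_if_commutes_with_conjugates\<close>). Hence, if a
  non-trivial set $K \subseteq G$ is closed under conjugation and under commutators with $G$, some
  commutator of an element of $K$ with a copy of a conjugate of $b$ below $1$ is a non-trivial element
  of $K$ acting below $1$ only (\<open>graft_preimage_nontrivial\<close>). Starting with $K = G$ and iterating, the
  rigid stabilizers of the vertices $1^n$ are all non-trivial. They decrease to the trivial group, so each of them is infinite.

  Activity. If $A_n$ is the activity of $a$, the recursion gives $A_{n+4} = A_{n+1} + 2A_n$. Its
  positive solutions grow at least like $(4/3)^n$ because $(4/3)^4 \le 4/3 + 2$.
\<close>

section \<open>Tree automorphisms and their restrictions\<close>

text \<open>The inverse as a map, as opposed to the inverse operation of a group structure.\<close>

abbreviation ginv :: "('a \<Rightarrow> 'a) \<Rightarrow> 'a \<Rightarrow> 'a" where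
  "ginv g \<equiv> inv_into UNIV g"

lemma tree_autD:
  assumes "g \<in> tree_aut"
  shows "bij g" "inj g" "length (g v) = length v" "prefix v w \<Longrightarrow> prefix (g v) (g w)"
  using assms by (auto simp: tree_aut_def bij_def)

lemma tree_aut_inv_cancel:
  assumes "g \<in> tree_aut"
  shows "g (ginv g w) = w" "ginv g (g w) = w"
  using tree_autD(1)[OF assms] by (auto simp: bij_def surj_f_inv_f)

lemma tree_aut_inv_comp [simp]:
  assumes "g \<in> tree_aut"
  shows "g \<circ> ginv g = id" "ginv g \<circ> g = id"
  using tree_autD(1)[OF assms] by (auto simp: bij_def surj_iff inj_iff)

lemma tree_aut_id [simp]: "id \<in> tree_aut"
  by (simp add: tree_aut_def)

lemma tree_aut_comp [simp]: "f \<in> tree_aut \<Longrightarrow> g \<in> tree_aut \<Longrightarrow> f \<circ> g \<in> tree_aut"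
  by (auto simp: tree_aut_def intro: bij_comp)

text \<open>Preservation of prefixes carries over to the inverse because an automorphism commutes with
  truncation.\<close>

lemma tree_aut_take:
  assumes "g \<in> tree_aut"
  shows "g (take n w) = take n (g w)"
proof -
  obtain z where "g w = g (take n w) @ z"
    using tree_autD(4)[OF assms take_is_prefix] by (auto simp: prefix_def)
  then show ?thesis
    using tree_autD(3)[OF assms, of "take n w"] by (cases "n \<le> length w") auto
qed

lemma tree_aut_inv [simp]:
  assumes g: "g \<in> tree_aut"
  shows "ginv g \<in> tree_aut"
proof -
  have len: "length (ginv g v) = length v" for v
    using tree_autD(3)[OF g, of "ginv g v"] tree_aut_inv_cancel[OF g] by simp
  moreover have "prefix (ginv g v) (ginv g w)" if vw: "prefix v w" for v w
  proof -
    have "g (take (length v) (ginv g w)) = v"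
      using tree_aut_take[OF g] tree_aut_inv_cancel[OF g] vw by (auto simp: prefix_def)
    then have "ginv g v = take (length v) (ginv g w)"
      using g by (metis tree_aut_inv_cancel(2))
    then show ?thesis
      by (simp add: take_is_prefix)
  qed
  ultimately show ?thesis
    using bij_imp_bij_inv[OF tree_autD(1)[OF g]] by (auto simp: tree_aut_def)
qed

lemma group_Aut: "group Aut"
proof (rule groupI)
  fix g :: "'a list \<Rightarrow> 'a list"
  assume "g \<in> carrier Aut"
  then show "\<exists>h\<in>carrier Aut. h \<otimes>\<^bsub>Aut\<^esub> g = \<one>\<^bsub>Aut\<^esub>"
    by (intro bexI[of _ "ginv g"]) (auto simp: Aut_def)
qed (auto simp: Aut_def comp_assoc)

lemma m_inv_Aut:
  assumes "g \<in> tree_aut"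
  shows "inv\<^bsub>Aut\<^esub> g = ginv g"
  by (rule group.inv_equality[OF group_Aut]) (use assms in \<open>auto simp: Aut_def\<close>)

lemma tree_aut_Cons:
  assumes "g \<in> tree_aut"
  shows "g (x # w) = hd (g [x]) # restriction g [x] w"
proof -
  have "length (g [x]) = 1"
    using tree_autD(3)[OF assms] by simp
  then have "g [x] = [hd (g [x])]"
    by (cases "g [x]") auto
  then show ?thesis
    using restriction_append[OF assms, of "[x]" w] by simp
qed

lemma restriction_eqI:
  assumes "\<And>w. g (v @ w) = u @ h w" "length u = length v"
  shows "restriction g v = h"
  using assms by (auto simp: restriction_def)

lemma restriction_id [simp]: "restriction id v = id"
  by (rule restriction_eqI) auto

lemma restriction_Nil [simp]: "restriction g [] = g"
  by (rule restriction_eqI) auto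

lemma restriction_restriction: "restriction (restriction g u) v = restriction g (u @ v)"
  by (auto simp: restriction_def add.commute)

lemma restriction_comp:
  assumes "f \<in> tree_aut" "g \<in> tree_aut"
  shows "restriction (f \<circ> g) v = restriction f (g v) \<circ> restriction g v"
  by (rule restriction_eqI[where u = "f (g v)"])
    (use assms in \<open>auto simp: restriction_append tree_autD(3)\<close>)

lemma restriction_inv:
  assumes g: "g \<in> tree_aut"
  shows "restriction (ginv g) v = ginv (restriction g (ginv g v))"
proof (rule restriction_eqI[where u = "ginv g v"])
  fix w
  let ?h = "restriction g (ginv g v)"
  have "g (ginv g v @ ginv ?h w) = v @ w"
    using restriction_in_tree_aut[OF g] by (simp add: restriction_append g tree_aut_inv_cancel)
  then show "ginv g (v @ w) = ginv g v @ ginv ?h w"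
    using g by (metis tree_aut_inv_cancel(2))
qed (use tree_autD(3)[OF tree_aut_inv[OF g]] in simp)

definition eventually_in :: "('x list \<Rightarrow> 'x list) \<Rightarrow> ('x list \<Rightarrow> 'x list) set \<Rightarrow> bool" where
  "eventually_in g N \<longleftrightarrow> (\<exists>k. \<forall>v. k \<le> length v \<longrightarrow> restriction g v \<in> N)"

text \<open>This is the induction step that makes contraction a finite check: only restrictions of
  products of a restriction of \<open>t\<close> with an element of \<open>N\<close> have to be examined. The depth \<open>K\<close> has to be uniform,
  since the first \<open>k\<close> letters of \<open>v\<close> are used up to bring \<open>g\<close> into \<open>N\<close>.\<close>

lemma eventually_in_mult:
  assumes t: "t \<in> tree_aut" and g: "g \<in> tree_aut" "eventually_in g N"
    and K: "\<And>n u v. n \<in> N \<Longrightarrow> K \<le> length v \<Longrightarrow> restriction (restriction t u \<circ> n) v \<in> N"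
  shows "eventually_in (t \<circ> g) N"
proof -
  obtain k where k: "\<And>v. k \<le> length v \<Longrightarrow> restriction g v \<in> N"
    using g(2) by (auto simp: eventually_in_def)
  have "restriction (t \<circ> g) v \<in> N" if v: "k + K \<le> length v" for v
  proof -
    let ?u = "take k v" and ?w = "drop k v"
    have "restriction (t \<circ> g) v = restriction (restriction (t \<circ> g) ?u) ?w"
      by (simp add: restriction_restriction)
    also have "\<dots> = restriction (restriction t (g ?u) \<circ> restriction g ?u) ?w"
      by (simp add: restriction_comp t g)
    also have "\<dots> \<in> N"
      using v by (intro K k) auto
    finally show ?thesis .
  qed
  then show ?thesis
    unfolding eventually_in_def by blast
qed

text \<open>Move the first letter into place; self-replication then allows the rest of the word to be
  corrected by an element that fixes the first level.\<close>

lemma level_transitive_if_self_replicating: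
  assumes sr: "self_replicating G"
  shows "level_transitive G"
proof -
  have sub: "subgroup G Aut"
    using sr by (simp add: self_replicating_def self_similar_def)
  have GT: "G \<subseteq> tree_aut" and comp: "\<And>f g. f \<in> G \<Longrightarrow> g \<in> G \<Longrightarrow> f \<circ> g \<in> G" and id: "id \<in> G"
    using sub by (auto simp: subgroup_def Aut_def)
  have "\<exists>g\<in>G. g v = w" if "length v = length w" for v w
    using that
  proof (induction v w rule: list_induct2)
    case Nil
    have "id [] = ([] :: 'a list)" by simp
    with id show ?case by blast
  next
    case (Cons x v y w)
    obtain g where g: "g \<in> G" "g [x] = [y]"
      using sr unfolding self_replicating_def by blast
    let ?u = "restriction g [x] v"
    have gT: "g \<in> tree_aut" using g GT by auto
    have ss: "restriction g [x] \<in> G"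
      using sr g by (auto simp: self_replicating_def self_similar_def)
    obtain k where k: "k \<in> G" "k v = w"
      using Cons by auto
    define k' where "k' = k \<circ> ginv (restriction g [x])"
    have rT: "restriction g [x] \<in> tree_aut"
      using ss GT by auto
    have "ginv (restriction g [x]) \<in> G"
      using subgroup.m_inv_closed[OF sub ss] m_inv_Aut rT by metis
    then have k': "k' \<in> G" "k' ?u = w"
      using comp[OF k(1)] k(2) tree_aut_inv_cancel[OF rT] by (auto simp: k'_def)
    then have "k' \<in> (\<lambda>g. restriction g [y]) ` level1_stabilizer G"
      using sr by (simp add: self_replicating_def)
    then obtain h where h: "h \<in> G" "h [y] = [y]" "restriction h [y] = k'"
      by (auto simp: level1_stabilizer_def)
    have "g (x # v) = y # ?u"
      using tree_aut_Cons[OF gT, of x v] g(2) by simp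
    moreover have "h (y # ?u) = y # w"
      using tree_aut_Cons[of h y ?u] h k'(2) GT by auto
    ultimately have "(h \<circ> g) (x # v) = y # w"
      by simp
    then show ?case
      using comp[OF h(1) g(1)] by blast
  qed
  then show ?thesis
    by (auto simp: level_transitive_def)
qed

section \<open>Words in the generators\<close>

text \<open>Words over the states and their formal inverses make restriction computable. The flag in a
  letter is \<open>True\<close> for the inverse of a state.\<close>

abbreviation "aut_of \<equiv> act Pi_automaton"

lemma Pi_automaton_simps [simp]:
  "next_state Pi_automaton = pi_next" "output_letter Pi_automaton = pi_output"
  by (simp_all add: Pi_automaton_def)

lemma pi_output_involution [simp]: "pi_output q (pi_output q x) = x"
  by (cases q) auto

lemma aut_of_tree_aut [simp]: "aut_of q \<in> tree_aut"
proof -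
  have len: "length (aut_of q v) = length v" for q v
    by (induction v arbitrary: q) auto
  have "prefix (aut_of q v) (aut_of q (v @ w))" for q v w
    by (induction v arbitrary: q) auto
  then have pre: "prefix v w \<Longrightarrow> prefix (aut_of q v) (aut_of q w)" for q v w
    by (auto simp: prefix_def)
  have inj: "aut_of q v = aut_of q w \<Longrightarrow> v = w" for q v w
  proof (induction v arbitrary: q w)
    case Nil
    then show ?case using len[of q w] by simp
  next
    case (Cons x v)
    then obtain y w' where w: "w = y # w'"
      using len[of q w] by (cases w) auto
    have "x = y"
      using Cons.prems by (metis (no_types) w act.simps(2) Pi_automaton_simps(2) list.inject pi_output_involution)
    with Cons show ?case
      by (auto simp: w)
  qed
  have "\<exists>v. aut_of q v = w" for q w
  proof (induction w arbitrary: q)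
    case Nil
    then show ?case by (intro exI[of _ "[]"]) simp
  next
    case (Cons y w)
    obtain v where "aut_of (pi_next q (pi_output q y)) v = w"
      using Cons by blast
    then have "aut_of q (pi_output q y # v) = y # w"
      by simp
    then show ?case by blast
  qed
  then have "bij (aut_of q)"
    unfolding bij_def using inj by (metis injI surjI)
  with len pre show ?thesis
    by (simp add: tree_aut_def)
qed

lemma restriction_aut_of [simp]: "restriction (aut_of q) [x] = aut_of (pi_next q x)"
  by (rule restriction_eqI[where u = "[pi_output q x]"]) simp_all

lemma aut_S1 [simp]: "aut_of S1 = id"
  by (rule act_S1)

type_synonym letter = "state \<times> bool"

fun letter_aut :: "letter \<Rightarrow> bool list \<Rightarrow> bool list" where
  "letter_aut (q, e) = (if e then ginv (aut_of q) else aut_of q)"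

fun letter_next :: "letter \<Rightarrow> bool \<Rightarrow> letter" where
  "letter_next (q, False) x = (pi_next q x, False)"
| "letter_next (q, True) x = (pi_next q (pi_output q x), True)"

lemma letter_aut_tree_aut [simp]: "letter_aut l \<in> tree_aut"
  by (cases l) auto

lemma letter_aut_Cons:
  "letter_aut l (x # w) = pi_output (fst l) x # letter_aut (letter_next l x) w"
proof (cases l)
  case (Pair q e)
  let ?y = "pi_output q x"
  have "aut_of q (?y # ginv (aut_of (pi_next q ?y)) w) = x # w"
    by (simp add: tree_aut_inv_cancel)
  then have "ginv (aut_of q) (x # w) = ?y # ginv (aut_of (pi_next q ?y)) w"
    by (metis aut_of_tree_aut tree_aut_inv_cancel(2))
  then show ?thesis
    by (cases e) (simp_all add: Pair)
qed

primrec word_aut :: "letter list \<Rightarrow> bool list \<Rightarrow> bool list" where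
  "word_aut [] = id"
| "word_aut (l # u) = letter_aut l \<circ> word_aut u"

lemma word_aut_tree_aut [simp]: "word_aut u \<in> tree_aut"
  by (induction u) (auto simp del: id_apply comp_apply)

lemma word_aut_append: "word_aut (u @ v) = word_aut u \<circ> word_aut v"
  by (induction u) (auto simp: comp_assoc)

text \<open>Prepending a letter with free cancellation and with the trivial state dropped. Every restricted
  word is built this way, which keeps it short enough to be recognised among finitely many words.\<close>

fun push :: "letter \<Rightarrow> letter list \<Rightarrow> letter list" where
  "push (q, e) u = (case q of S1 \<Rightarrow> u
     | _ \<Rightarrow> (case u of [] \<Rightarrow> [(q, e)]
              | (q', e') # u' \<Rightarrow> if q = q' \<and> e \<noteq> e' then u' else (q, e) # u))"

lemma word_aut_push: "word_aut (push l u) = letter_aut l \<circ> word_aut u"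
proof -
  obtain q e where l: "l = (q, e)" by (cases l)
  have cancel: "letter_aut (q, \<not> e) \<circ> (letter_aut (q, e) \<circ> h) = h" for q e h
    by (cases e) (auto simp: fun_eq_iff tree_aut_inv_cancel)
  have cancel': "letter_aut (q, False) \<circ> (letter_aut (q, True) \<circ> h) = h"
    "letter_aut (q, True) \<circ> (letter_aut (q, False) \<circ> h) = h" for q h
    using cancel[of q True] cancel[of q False] by simp_all
  have S1: "letter_aut (S1, e) = id" for e
    by (auto simp: fun_eq_iff inv_id)
  show ?thesis
    by (auto simp: l S1 cancel' split: state.split list.split simp del: letter_aut.simps)
qed

fun word_step :: "letter list \<Rightarrow> bool \<Rightarrow> bool \<times> letter list" where
  "word_step [] x = (x, [])"
| "word_step (l # u) x =
     (case word_step u x of (y, v) \<Rightarrow> (pi_output (fst l) y, push (letter_next l y) v))"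

lemma word_aut_Cons:
  "word_aut u (x # w) = fst (word_step u x) # word_aut (snd (word_step u x)) w"
  by (induction u) (auto simp: word_aut_push letter_aut_Cons split: prod.split)

lemma restriction_word_aut [simp]: "restriction (word_aut u) [x] = word_aut (snd (word_step u x))"
  by (rule restriction_eqI[where u = "[fst (word_step u x)]"]) (simp_all add: word_aut_Cons)

lemma restriction_letter_aut [simp]: "restriction (letter_aut l) [x] = letter_aut (letter_next l x)"
  by (rule restriction_eqI[where u = "[pi_output (fst l) x]"]) (simp_all add: letter_aut_Cons)

section \<open>The group\<close>

lemma subgroup_Pi_group: "subgroup Pi_group Aut"
  unfolding Pi_group_def
  by (rule group.generate_is_subgroup[OF group_Aut])
    (auto simp: Aut_def aut_a_def aut_b_def aut_c_def aut_d_def)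

lemma Pi_group_closed [simp]:
  shows Pi_group_tree_aut: "g \<in> Pi_group \<Longrightarrow> g \<in> tree_aut"
    and Pi_group_id: "id \<in> Pi_group"
    and Pi_group_comp: "f \<in> Pi_group \<Longrightarrow> g \<in> Pi_group \<Longrightarrow> f \<circ> g \<in> Pi_group"
    and Pi_group_inv: "g \<in> Pi_group \<Longrightarrow> ginv g \<in> Pi_group"
proof -
  show T: "g \<in> Pi_group \<Longrightarrow> g \<in> tree_aut" for g
    using subgroup_Pi_group by (auto simp: subgroup_def Aut_def)
  show "id \<in> Pi_group" "f \<in> Pi_group \<Longrightarrow> g \<in> Pi_group \<Longrightarrow> f \<circ> g \<in> Pi_group"
    using subgroup_Pi_group by (auto simp: subgroup_def Aut_def)
  show "ginv g \<in> Pi_group" if "g \<in> Pi_group"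
    using subgroup.m_inv_closed[OF subgroup_Pi_group that] m_inv_Aut[OF T[OF that]] by simp
qed

lemma aut_of_in_Pi_group [simp]: "aut_of q \<in> Pi_group"
proof (cases q)
  case S1
  then show ?thesis by simp
qed (auto simp: Pi_group_def aut_a_def aut_b_def aut_c_def aut_d_def intro!: generate.incl)

lemma letter_aut_in_Pi_group [simp]: "letter_aut l \<in> Pi_group"
  by (cases l) auto

lemma word_aut_in_Pi_group [simp]: "word_aut u \<in> Pi_group"
  by (induction u) (auto simp del: id_apply comp_apply)

lemma Pi_group_eq_words: "Pi_group = range word_aut"
proof -
  have "\<exists>u. g = word_aut u" if "g \<in> Pi_group" for g
    using that unfolding Pi_group_def
  proof (induction rule: generate.induct)
    case one
    show ?case by (intro exI[of _ "[]"]) (simp add: Aut_def)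
  next
    case (incl h)
    then obtain q where "h = aut_of q"
      by (auto simp: aut_a_def aut_b_def aut_c_def aut_d_def)
    then show ?case by (intro exI[of _ "[(q, False)]"]) simp
  next
    case (inv h)
    then obtain q where "h = aut_of q"
      by (auto simp: aut_a_def aut_b_def aut_c_def aut_d_def)
    then show ?case by (intro exI[of _ "[(q, True)]"]) (simp add: m_inv_Aut)
  next
    case (eng h1 h2)
    then obtain u1 u2 where "h1 = word_aut u1" "h2 = word_aut u2" by auto
    then have "h1 \<otimes>\<^bsub>Aut\<^esub> h2 = word_aut (u1 @ u2)"
      by (simp add: Aut_def word_aut_append)
    then show ?case by blast
  qed
  then show ?thesis by auto
qed

lemma self_similar_Pi_group: "self_similar Pi_group"
  unfolding self_similar_def using subgroup_Pi_group
  by (auto simp: Pi_group_eq_words)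

lemma restriction_in_Pi_group [simp]:
  assumes "g \<in> Pi_group"
  shows "restriction g v \<in> Pi_group"
  using assms
proof (induction v arbitrary: g)
  case (Cons x v)
  have "restriction g (x # v) = restriction (restriction g [x]) v"
    by (simp add: restriction_restriction)
  moreover have "restriction g [x] \<in> Pi_group"
    using Cons.prems self_similar_Pi_group by (simp add: self_similar_def)
  ultimately show ?case
    using Cons.IH by simp
qed simp

section \<open>Contraction\<close>

text \<open>The set $P$ of the introduction: the words of length at most two along the cycle
  $a \to c \to b \to d \to a$.\<close>

definition chains :: "state list list" where
  "chains = [[], [Sa], [Sb], [Sc], [Sd], [Sa, Sc], [Sc, Sb], [Sb, Sd], [Sd, Sa]]"

definition quotient_word :: "state list \<times> state list \<Rightarrow> letter list" where
  "quotient_word = (\<lambda>(u, v). map (\<lambda>q. (q, True)) (rev u) @ map (\<lambda>q. (q, False)) v)"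

text \<open>The squares are needed for closure: the restriction of $cb$ at $0$ is $a^2$, and an element of
  $P$ that takes a letter to $0$ restricts there to $1$, $a$ or $a^2$.\<close>

definition quotient_words :: "letter list list" where
  "quotient_words = [(Sa, False), (Sa, False)] # [(Sa, True), (Sa, True)] #
     map quotient_word (List.product chains chains)"

text \<open>Membership in \<open>quotient_words\<close>, decided by splitting off the leading inverse letters and
  not by comparison with the whole list, as it is evaluated thousands of times.\<close>

definition is_quotient :: "letter list \<Rightarrow> bool" where
  "is_quotient u \<longleftrightarrow> u = [(Sa, False), (Sa, False)] \<or> u = [(Sa, True), (Sa, True)] \<or>
     rev (map fst (takeWhile snd u)) \<in> set chains \<and>
     map fst (dropWhile snd u) \<in> set chains \<and>
     list_all (\<lambda>l. \<not> snd l) (dropWhile snd u)"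

lemma is_quotient_in_quotient_words:
  assumes "is_quotient u"
  shows "u \<in> set quotient_words"
proof -
  let ?n = "takeWhile snd u" and ?p = "dropWhile snd u"
  consider "u = [(Sa, False), (Sa, False)]" | "u = [(Sa, True), (Sa, True)]"
    | "rev (map fst ?n) \<in> set chains" "map fst ?p \<in> set chains"
      "list_all (\<lambda>l. \<not> snd l) ?p"
    using assms unfolding is_quotient_def by blast
  then show ?thesis
  proof cases
    case 3
    have "map (\<lambda>q. (q, True)) (map fst ?n) = ?n"
      unfolding map_map by (rule map_idI) (auto dest: set_takeWhileD)
    moreover have "map (\<lambda>q. (q, False)) (map fst ?p) = ?p"
      unfolding map_map using 3(3) by (intro map_idI) (auto simp: list_all_iff)
    ultimately have "u = quotient_word (rev (map fst ?n), map fst ?p)"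
      by (simp only: quotient_word_def prod.case rev_rev_ident takeWhile_dropWhile_id)
    moreover have "(rev (map fst ?n), map fst ?p) \<in> set chains \<times> set chains"
      using 3(1,2) by (rule SigmaI)
    ultimately show ?thesis
      unfolding quotient_words_def list.set set_map set_product by (metis imageI insertCI)
  qed (simp_all add: quotient_words_def)
qed

text \<open>Within \<open>k\<close> letters, every branch of restrictions meets a quotient word. A branch may
  stop there because the quotients are closed under restriction.\<close>

primrec quotient_within :: "nat \<Rightarrow> letter list \<Rightarrow> bool" where
  "quotient_within 0 u = is_quotient u"
| "quotient_within (Suc k) u = (is_quotient u \<or>
     (quotient_within k (snd (word_step u False)) \<and> quotient_within k (snd (word_step u True))))"

definition letters :: "letter list" where
  "letters = List.product [S1, Sa, Sb, Sc, Sd] [False, True]"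

lemma quotient_words_closed:
  "list_all (\<lambda>u. is_quotient (snd (word_step u False)) \<and> is_quotient (snd (word_step u True)))
     quotient_words"
  by code_simp

text \<open>The heart of the contraction property: seven letters absorb one additional generator.\<close>

lemma letter_times_quotient_within:
  "list_all (\<lambda>u. list_all (\<lambda>l. quotient_within 7 (l # u)) letters) quotient_words"
  by code_simp

definition quotients :: "(bool list \<Rightarrow> bool list) set" where
  "quotients = word_aut ` set quotient_words"

lemma is_quotient_imp_in_quotients: "is_quotient u \<Longrightarrow> word_aut u \<in> quotients"
  by (auto simp: quotients_def dest: is_quotient_in_quotient_words)

lemma restriction_Cons: "restriction g (x # v) = restriction (restriction g [x]) v"
  by (simp add: restriction_restriction)

lemma restriction_quotients:
  assumes "g \<in> quotients"
  shows "restriction g v \<in> quotients"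
  using assms
proof (induction v arbitrary: g)
  case (Cons x v)
  then obtain u where u: "g = word_aut u" "u \<in> set quotient_words"
    by (auto simp: quotients_def)
  then have "is_quotient (snd (word_step u x))"
    using quotient_words_closed by (cases x) (auto simp: list_all_iff)
  then have "restriction g [x] \<in> quotients"
    by (simp add: u is_quotient_imp_in_quotients)
  then show ?case
    by (subst restriction_Cons) (rule Cons.IH)
qed simp

lemma restriction_quotient_within:
  assumes "quotient_within k u" "k \<le> length v"
  shows "restriction (word_aut u) v \<in> quotients"
  using assms
proof (induction k arbitrary: u v)
  case 0
  then show ?case
    by (simp add: is_quotient_imp_in_quotients restriction_quotients)
next
  case (Suc k)
  show ?case
  proof (cases "is_quotient u")
    case True
    then show ?thesis
      by (simp add: is_quotient_imp_in_quotients restriction_quotients)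
  next
    case False
    obtain x v' where v: "v = x # v'"
      using Suc.prems(2) by (cases v) auto
    have "quotient_within k (snd (word_step u x))"
      using Suc.prems(1) False by (cases x) auto
    then have "restriction (word_aut (snd (word_step u x))) v' \<in> quotients"
      using Suc by (simp add: v)
    then show ?thesis
      by (simp add: v restriction_Cons[of _ x v'])
  qed
qed

lemma restriction_letter_aut_letter: "\<exists>l'. restriction (letter_aut l) v = letter_aut l'"
proof (induction v arbitrary: l)
  case Nil
  show ?case by (rule exI[of _ l]) simp
next
  case (Cons x v)
  then show ?case
    by (metis restriction_Cons restriction_letter_aut)
qed

lemma restriction_letter_times_quotient:
  assumes "n \<in> quotients" "7 \<le> length v"
  shows "restriction (letter_aut l \<circ> n) v \<in> quotients"
proof -
  obtain u where u: "n = word_aut u" "u \<in> set quotient_words"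
    using assms(1) by (auto simp: quotients_def)
  have "l \<in> set letters"
    by (cases l; cases "fst l") (auto simp: letters_def)
  then have "quotient_within 7 (l # u)"
    using letter_times_quotient_within u(2) unfolding list_all_iff by blast
  from restriction_quotient_within[OF this assms(2)] show ?thesis
    by (simp add: u(1))
qed

lemma id_in_quotients: "id \<in> quotients"
  using is_quotient_imp_in_quotients[of "[]"] by (simp add: is_quotient_def chains_def)

lemma eventually_in_quotients: "eventually_in (word_aut u) quotients"
proof (induction u)
  case Nil
  have "eventually_in id quotients"
    by (simp add: eventually_in_def id_in_quotients)
  then show ?case by (simp only: word_aut.simps)
next
  case (Cons l u)
  have "eventually_in (letter_aut l \<circ> word_aut u) quotients"
  proof (rule eventually_in_mult[where K = 7, OF letter_aut_tree_aut word_aut_tree_aut Cons.IH])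
    fix n :: "bool list \<Rightarrow> bool list" and w v :: "bool list"
    assume "n \<in> quotients" "7 \<le> length v"
    then show "restriction (restriction (letter_aut l) w \<circ> n) v \<in> quotients"
      using restriction_letter_aut_letter[of l w] restriction_letter_times_quotient by metis
  qed
  then show ?case by (simp only: word_aut.simps)
qed

lemma absorbing_quotients: "absorbing Pi_group quotients"
  unfolding absorbing_def
  using eventually_in_quotients
  by (auto simp: Pi_group_eq_words quotients_def eventually_in_def)

lemma contracting_Pi_group: "contracting Pi_group"
  using self_similar_Pi_group absorbing_quotients by (auto simp: contracting_def)

lemma absorbing_nonempty:
  assumes "absorbing G N" "G \<noteq> {}"
  shows "N \<noteq> {}"
proof -
  obtain g where "g \<in> G"
    using assms(2) by blast
  then obtain k where "\<forall>v. k \<le> length v \<longrightarrow> restriction g v \<in> N"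
    using assms(1) unfolding absorbing_def by blast
  then have "restriction g (replicate k undefined) \<in> N" by simp
  then show ?thesis by blast
qed

text \<open>The intersection of the two sets is absorbing, and the nucleus is minimal.\<close>

lemma nucleus_subset_absorbing:
  assumes "is_nucleus G M" "absorbing G N"
  shows "M \<subseteq> N"
  using assms absorbing_Int[of G M N] unfolding is_nucleus_def by blast

section \<open>The open set condition\<close>

primrec identity_within :: "nat \<Rightarrow> letter list \<Rightarrow> bool" where
  "identity_within 0 u = (u = [])"
| "identity_within (Suc k) u = (u = [] \<or> identity_within k (snd (word_step u False)) \<or> identity_within k (snd (word_step u True)))"

lemma quotient_words_identity_within: "list_all (identity_within 3) quotient_words"
  by code_simp

lemma restriction_identity_within: "identity_within k u \<Longrightarrow> \<exists>v. restriction (word_aut u) v = id"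
proof (induction k arbitrary: u)
  case 0
  then have "restriction (word_aut u) [] = id" by simp
  then show ?case ..
next
  case (Suc k)
  show ?case
  proof (cases "u = []")
    case True
    then have "restriction (word_aut u) [] = id" by simp
    then show ?thesis ..
  next
    case False
    then obtain x where "identity_within k (snd (word_step u x))"
      using Suc.prems by auto
    then obtain v where "restriction (word_aut (snd (word_step u x))) v = id"
      using Suc.IH by blast
    then have "restriction (word_aut u) (x # v) = id"
      by (simp add: restriction_Cons[of _ x v])
    then show ?thesis ..
  qed
qed

lemma open_set_condition_Pi_group: "open_set_condition Pi_group"
proof -
  obtain M where M: "is_nucleus Pi_group M"
    using contracting_ex1_nucleus[OF contracting_Pi_group] by blast
  have "\<exists>v. restriction g v = id" if "g \<in> quotients" for g
    using that quotient_words_identity_within restriction_identity_within by (auto simp: quotients_def list_all_iff)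
  then have "\<forall>g\<in>M. \<exists>v. restriction g v = id"
    using nucleus_subset_absorbing[OF M absorbing_quotients] by blast
  with M contracting_Pi_group show ?thesis
    by (auto simp: open_set_condition_def)
qed

section \<open>Self-replication\<close>

lemma ginv_aut_of_simps [simp]:
  "ginv (aut_of q) [] = []"
  "ginv (aut_of q) (x # w) = pi_output q x # ginv (aut_of (pi_next q (pi_output q x))) w"
  "aut_of q (ginv (aut_of q) w) = w"
  "ginv (aut_of q) (aut_of q w) = w"
proof -
  show "ginv (aut_of q) [] = []"
    using tree_autD(3)[OF tree_aut_inv[OF aut_of_tree_aut], of q "[]"] by simp
  show "ginv (aut_of q) (x # w) = pi_output q x # ginv (aut_of (pi_next q (pi_output q x))) w"
    using letter_aut_Cons[of "(q, True)" x w] by simp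
qed (simp_all add: tree_aut_inv_cancel)

lemma ginv_comp:
  assumes "f \<in> tree_aut" "g \<in> tree_aut"
  shows "ginv (f \<circ> g) = ginv g \<circ> ginv f"
  using o_inv_distrib tree_autD(1)[OF assms(1)] tree_autD(1)[OF assms(2)] by blast

lemma ginv_ginv [simp]: "g \<in> tree_aut \<Longrightarrow> ginv (ginv g) = g"
  by (simp add: inv_inv_eq tree_autD(1))

lemma ginv_fix: "g \<in> tree_aut \<Longrightarrow> g w = w \<Longrightarrow> ginv g w = w"
  by (metis tree_aut_inv_cancel(2))

text \<open>The restrictions at \<open>x\<close> of elements that fix the first level are closed under products and
  inverses, so it is enough to realise the generators.\<close>

lemma lift_to_level1_stabilizer:
  assumes "g \<in> Pi_group"
  shows "\<exists>h\<in>level1_stabilizer Pi_group. restriction h [x] = g"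
proof -
  define L where "L = (\<lambda>h. restriction h [x]) ` level1_stabilizer Pi_group"
  have L: "g \<in> L" if "h \<in> Pi_group" "\<And>y. h [y] = [y]" "\<And>w. h (x # w) = x # g w" for g h
  proof -
    have "restriction h [x] = g"
      by (rule restriction_eqI[where u = "[x]"]) (simp_all add: that(3))
    with that(1,2) show ?thesis
      by (auto simp: L_def level1_stabilizer_def)
  qed
  (* At 1: c, b, d and a^2 restrict to a, c, b and d.
     At 0: b, a d a^-1, a b a^-1 and a^2 restrict to a, b, c and d. *)
  have gens: "aut_of q \<in> L" for q
  proof (cases q)
    case S1
    show ?thesis by (rule L[of id]) (simp_all add: S1)
  next
    case Sa
    show ?thesis by (cases x; rule L[of "if x then aut_of Sc else aut_of Sb"]) (simp_all add: Sa)
  next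
    case Sb
    show ?thesis
      by (cases x; rule L[of "if x then aut_of Sd else aut_of Sa \<circ> aut_of Sd \<circ> ginv (aut_of Sa)"])
        (simp_all add: Sb inv_id split: bool.split)
  next
    case Sc
    show ?thesis
      by (cases x; rule L[of "if x then aut_of Sb else aut_of Sa \<circ> aut_of Sb \<circ> ginv (aut_of Sa)"])
        (simp_all add: Sc inv_id)
  next
    case Sd
    show ?thesis
      by (cases x; rule L[of "aut_of Sa \<circ> aut_of Sa"]) (simp_all add: Sd)
  qed
  have mult: "f \<circ> g \<in> L" if fg: "f \<in> L" "g \<in> L" for f g
  proof -
    obtain h k where "h \<in> level1_stabilizer Pi_group" "k \<in> level1_stabilizer Pi_group"
      "f = restriction h [x]" "g = restriction k [x]"
      using fg by (auto simp: L_def)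
    then have "h \<circ> k \<in> level1_stabilizer Pi_group" "restriction (h \<circ> k) [x] = f \<circ> g"
      by (simp_all add: level1_stabilizer_def restriction_comp)
    then show ?thesis
      unfolding L_def by (metis imageI)
  qed
  have inv: "ginv f \<in> L" if f: "f \<in> L" for f
  proof -
    obtain h where "h \<in> level1_stabilizer Pi_group" "f = restriction h [x]"
      using f by (auto simp: L_def)
    then have "ginv h \<in> level1_stabilizer Pi_group" "restriction (ginv h) [x] = ginv f"
      by (simp_all add: level1_stabilizer_def restriction_inv ginv_fix)
    then show ?thesis
      unfolding L_def by (metis imageI)
  qed
  have "word_aut u \<in> L" for u
  proof (induction u)
    case Nil
    have "id \<in> L" using gens[of S1] by simp
    then show ?case by (simp only: word_aut.simps)
  next
    case (Cons l u)
    have "letter_aut l \<in> L"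
      by (cases l) (simp add: gens inv)
    from mult[OF this Cons.IH] show ?case by (simp only: word_aut.simps)
  qed
  then have "g \<in> L"
    using assms unfolding Pi_group_eq_words by blast
  then show ?thesis
    unfolding L_def by blast
qed

lemma self_replicating_Pi_group: "self_replicating Pi_group"
  unfolding self_replicating_def
proof (intro conjI allI self_similar_Pi_group)
  fix x y :: bool
  have "(if x = y then id else aut_of Sa) [x] = [y]"
    by auto
  then show "\<exists>g\<in>Pi_group. g [x] = [y]"
    by (metis Pi_group_id aut_of_in_Pi_group)
next
  fix x :: bool
  show "(\<lambda>g. restriction g [x]) ` level1_stabilizer Pi_group = Pi_group"
    using lift_to_level1_stabilizer[of _ x] by (fastforce simp: level1_stabilizer_def)
qed

lemma fractal_Pi_group: "fractal Pi_group"
  using self_replicating_Pi_group level_transitive_if_self_replicating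
  by (auto simp: fractal_def)

section \<open>Elements commuting with all conjugates of a generator\<close>

definition commutes_with_conjugates :: "(bool list \<Rightarrow> bool list) \<Rightarrow> (bool list \<Rightarrow> bool list) \<Rightarrow> bool" where
  "commutes_with_conjugates x s \<longleftrightarrow>
     (\<forall>g\<in>Pi_group. \<forall>w. x (g (s (ginv g w))) = g (s (ginv g (x w))))"

lemma commutes_with_conjugatesD:
  assumes "commutes_with_conjugates x s" "g \<in> Pi_group"
  shows "x (g (s (ginv g w))) = g (s (ginv g (x w)))"
  using assms unfolding commutes_with_conjugates_def by blast

lemma commutes_with_conjugates_commutes:
  assumes "commutes_with_conjugates x s"
  shows "x (s w) = s (x w)"
  using commutes_with_conjugatesD[OF assms Pi_group_id, of w] by (simp add: inv_id)

lemma commutes_with_conjugates_conj: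
  assumes c: "commutes_with_conjugates x s" and h: "h \<in> Pi_group"
  shows "commutes_with_conjugates (h \<circ> x \<circ> ginv h) s"
  unfolding commutes_with_conjugates_def
proof (intro ballI allI)
  fix g w
  assume g: "g \<in> Pi_group"
  have T: "g \<in> tree_aut" "h \<in> tree_aut"
    using g h by simp_all
  have "ginv (ginv h \<circ> g) = ginv g \<circ> h"
    using T by (simp add: ginv_comp)
  then have "x (ginv h (g (s (ginv g (h z))))) = ginv h (g (s (ginv g (h (x z)))))" for z
    using commutes_with_conjugatesD[OF c, of "ginv h \<circ> g" z] g h by simp
  from this[of "ginv h w"]
  show "(h \<circ> x \<circ> ginv h) (g (s (ginv g w))) = g (s (ginv g ((h \<circ> x \<circ> ginv h) w)))"
    using tree_aut_inv_cancel[OF T(2)] by simp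
qed

lemma commutes_with_conjugates_square:
  assumes c: "commutes_with_conjugates x s"
  shows "commutes_with_conjugates x (s \<circ> s)"
  unfolding commutes_with_conjugates_def
proof (intro ballI allI)
  fix g w
  assume g: "g \<in> Pi_group"
  have "ginv g (g z) = z" for z
    using tree_aut_inv_cancel(2)[of g z] g by simp
  then show "x (g ((s \<circ> s) (ginv g w))) = g ((s \<circ> s) (ginv g (x w)))"
    using commutes_with_conjugatesD[OF c g, of "g (s (ginv g w))"]
      commutes_with_conjugatesD[OF c g, of w] by simp
qed

text \<open>The commutator of \<open>s\<close> and \<open>h\<close> is the product of \<open>s\<close> with a conjugate of its inverse.\<close>

lemma commutes_with_conjugates_commutator:
  assumes c: "commutes_with_conjugates x s" and h: "h \<in> Pi_group" and s: "s \<in> Pi_group"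
  shows "x ((s \<circ> h \<circ> ginv s \<circ> ginv h) w) = (s \<circ> h \<circ> ginv s \<circ> ginv h) (x w)"
proof -
  have T: "s \<in> tree_aut" "h \<in> tree_aut"
    using s h by simp_all
  let ?z = "h (ginv s (ginv h w))"
  have "w = h (s (ginv h ?z))"
    using tree_aut_inv_cancel T by metis
  then have "x w = h (s (ginv h (x ?z)))"
    using commutes_with_conjugatesD[OF c h, of ?z] by metis
  then have "x ?z = h (ginv s (ginv h (x w)))"
    using tree_aut_inv_cancel T by metis
  then show ?thesis
    using commutes_with_conjugates_commutes[OF c, of ?z] by simp
qed

text \<open>If \<open>x\<close> commutes with \<open>r\<close>, it permutes the words moved by \<open>r\<close>; when there are such words and all of them
  begin with \<open>True\<close>, the letters cannot be swapped.\<close>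

lemma fixes_level1_if_commutes:
  fixes x r :: "bool list \<Rightarrow> bool list"
  assumes x: "x \<in> tree_aut" and comm: "\<And>w. x (r w) = r (x w)"
    and r: "\<And>w. r (False # w) = False # w" "r (True # u) \<noteq> True # u"
  shows "x [i] = [i]"
proof -
  have inj: "x v = x w \<Longrightarrow> v = w" for v w
    using tree_autD(2)[OF x] by (rule injD)
  have single: "\<exists>j. x [i] = [j]" for i
    using tree_autD(3)[OF x, of "[i]"] by (cases "x [i]") auto
  have "x [True] \<noteq> [False]"
  proof
    assume "x [True] = [False]"
    then have "x (True # u) = False # restriction x [True] u"
      using tree_aut_Cons[OF x, of True u] by simp
    then have "x (r (True # u)) = x (True # u)"
      by (simp add: comm r(1))
    then show False
      using inj r(2) by blast
  qed
  then have T: "x [True] = [True]"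
    using single[of True] by auto
  moreover have "x [False] = [False]"
    using single[of False] inj[of "[False]" "[True]"] T by auto
  ultimately show ?thesis by (cases i) auto
qed

lemma fixed_letter_Cons:
  assumes "f \<in> tree_aut" "f [i] = [i]"
  shows "f (i # w) = i # restriction f [i] w"
  using tree_aut_Cons[OF assms(1), of i w] assms(2) by simp

text \<open>Self-replication enters here: every conjugate of the restriction of \<open>s\<close> is the restriction
  of a conjugate of \<open>s\<close>.\<close>

lemma commutes_with_conjugates_restriction:
  assumes x: "x \<in> Pi_group" "x [i] = [i]" and s: "s \<in> Pi_group" "s [i] = [i]"
    and c: "commutes_with_conjugates x s"
  shows "commutes_with_conjugates (restriction x [i]) (restriction s [i])"
  unfolding commutes_with_conjugates_def
proof (intro ballI allI)
  fix g w
  assume "g \<in> Pi_group"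
  then obtain h where h: "h \<in> Pi_group" "h [i] = [i]" "restriction h [i] = g"
    using lift_to_level1_stabilizer[of g i] by (auto simp: level1_stabilizer_def)
  have hi: "ginv h [i] = [i]" "restriction (ginv h) [i] = ginv g"
    using h by (simp_all add: ginv_fix restriction_inv)
  have step: "h (i # v) = i # g v" "ginv h (i # v) = i # ginv g v"
      "s (i # v) = i # restriction s [i] v" "x (i # v) = i # restriction x [i] v" for v
    using fixed_letter_Cons[of h i v] fixed_letter_Cons[of "ginv h" i v]
      fixed_letter_Cons[of s i v] fixed_letter_Cons[of x i v] h hi x s by simp_all
  show "restriction x [i] (g (restriction s [i] (ginv g w))) =
        g (restriction s [i] (ginv g (restriction x [i] w)))"
    using commutes_with_conjugatesD[OF c h(1), of "i # w"] by (simp add: step)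
qed

text \<open>Since $b = (a, c)$, the restriction at $0$ is direct; the one at $1$ is the restriction at $0$
  of the conjugate of $x$ by $a$. The first level is fixed on account of the commutator of $b$ and $d$, which acts below $1$
  only.\<close>

lemma descent_from_b:
  assumes x: "x \<in> Pi_group" and c: "commutes_with_conjugates x (aut_of Sb)"
  shows "x [i] = [i] \<and> commutes_with_conjugates (restriction x [i]) (aut_of Sa)"
proof -
  let ?a = "aut_of Sa"
  have fix1: "y [i] = [i]" if y: "y \<in> Pi_group" "commutes_with_conjugates y (aut_of Sb)" for y i
  proof (rule fixes_level1_if_commutes)
    show "y \<in> tree_aut" using y by simp
    show "y ((aut_of Sb \<circ> aut_of Sd \<circ> ginv (aut_of Sb) \<circ> ginv (aut_of Sd)) w)
        = (aut_of Sb \<circ> aut_of Sd \<circ> ginv (aut_of Sb) \<circ> ginv (aut_of Sd)) (y w)" for w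
      by (rule commutes_with_conjugates_commutator) (use y in simp_all)
    show "(aut_of Sb \<circ> aut_of Sd \<circ> ginv (aut_of Sb) \<circ> ginv (aut_of Sd)) (True # [True, True, False, False, False])
        \<noteq> True # [True, True, False, False, False]"
      by (simp add: inv_id)
  qed (simp add: inv_id)
  have rest: "commutes_with_conjugates (restriction y [False]) ?a"
    if y: "y \<in> Pi_group" "commutes_with_conjugates y (aut_of Sb)" for y
    using commutes_with_conjugates_restriction[of y False "aut_of Sb"] fix1 y by simp
  have "restriction (?a \<circ> x \<circ> ginv ?a) [False] = restriction x [True]"
    by (rule restriction_eqI[where u = "[False]"])
      (use fixed_letter_Cons[of x True] fix1[OF x c] x in \<open>simp_all add: inv_id\<close>)
  then have "commutes_with_conjugates (restriction x [True]) ?a"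
    using rest[of "?a \<circ> x \<circ> ginv ?a"] commutes_with_conjugates_conj[OF c] x by simp
  with rest[OF x c] fix1[OF x c] show ?thesis
    by (cases i) auto
qed

text \<open>Here $a^2 = (d, d)$ handles both letters. The commutator of $a$ and $c$ acts below $1$ only.\<close>

lemma descent_from_a:
  assumes x: "x \<in> Pi_group" and c: "commutes_with_conjugates x (aut_of Sa)"
  shows "x [i] = [i] \<and> commutes_with_conjugates (restriction x [i]) (aut_of Sd)"
proof -
  have fix1: "x [i] = [i]" for i
  proof (rule fixes_level1_if_commutes)
    show "x \<in> tree_aut" using x by simp
    show "x ((aut_of Sa \<circ> aut_of Sc \<circ> ginv (aut_of Sa) \<circ> ginv (aut_of Sc)) w)
        = (aut_of Sa \<circ> aut_of Sc \<circ> ginv (aut_of Sa) \<circ> ginv (aut_of Sc)) (x w)" for w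
      by (rule commutes_with_conjugates_commutator) (use c in simp_all)
    show "(aut_of Sa \<circ> aut_of Sc \<circ> ginv (aut_of Sa) \<circ> ginv (aut_of Sc)) (True # [False, False, False])
        \<noteq> True # [False, False, False]"
      by (simp add: inv_id)
  qed (simp add: inv_id)
  have "restriction (aut_of Sa \<circ> aut_of Sa) [i] = aut_of Sd"
    by (cases i; rule restriction_eqI[where u = "[i]"]) simp_all
  then show ?thesis
    using commutes_with_conjugates_restriction[of x i "aut_of Sa \<circ> aut_of Sa"]
      commutes_with_conjugates_square[OF c] fix1 x by simp
qed

text \<open>Since $d = (1, b)$ itself acts below $1$ only, no commutator is needed. The restriction at $0$ is
  again reached by conjugating $x$, this time by $a^{-1}$.\<close>

lemma descent_from_d:
  assumes x: "x \<in> Pi_group" and c: "commutes_with_conjugates x (aut_of Sd)"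
  shows "x [i] = [i] \<and> commutes_with_conjugates (restriction x [i]) (aut_of Sb)"
proof -
  let ?a = "aut_of Sa"
  have fix1: "y [i] = [i]" if y: "y \<in> Pi_group" "commutes_with_conjugates y (aut_of Sd)" for y i
    by (rule fixes_level1_if_commutes[of y "aut_of Sd" "[False, False]"])
      (use y commutes_with_conjugates_commutes in simp_all)
  have rest: "commutes_with_conjugates (restriction y [True]) (aut_of Sb)"
    if y: "y \<in> Pi_group" "commutes_with_conjugates y (aut_of Sd)" for y
    using commutes_with_conjugates_restriction[of y True "aut_of Sd"] fix1 y by simp
  have "restriction (ginv ?a \<circ> x \<circ> ginv (ginv ?a)) [True] = restriction x [False]"
    by (rule restriction_eqI[where u = "[True]"])
      (use fixed_letter_Cons[of x False] fix1[OF x c] x in \<open>simp_all add: inv_id\<close>)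
  then have "commutes_with_conjugates (restriction x [False]) (aut_of Sb)"
    using rest[of "ginv ?a \<circ> x \<circ> ginv (ginv ?a)"] commutes_with_conjugates_conj[OF c, of "ginv ?a"] x
    by simp
  with rest[OF x c] fix1[OF x c] show ?thesis
    by (cases i) auto
qed

lemma trivial_if_commutes_with_conjugates:
  assumes "x \<in> Pi_group"
    and "\<exists>q\<in>{Sa, Sb, Sd}. commutes_with_conjugates x (aut_of q)"
  shows "x w = w"
  using assms
proof (induction w arbitrary: x)
  case Nil
  then show ?case
    using tree_autD(3)[of x "[]"] by simp
next
  case (Cons i w)
  have "x [i] = [i] \<and> (\<exists>q\<in>{Sa, Sb, Sd}. commutes_with_conjugates (restriction x [i]) (aut_of q))"
    using Cons.prems descent_from_a[of x i] descent_from_b[of x i]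
      descent_from_d[of x i] by blast
  then show ?case
    using Cons.IH[of "restriction x [i]"] fixed_letter_Cons[of x i w] Cons.prems(1) by simp
qed

section \<open>Rigid stabilizers\<close>

text \<open>The copy of \<open>y\<close> that acts below the vertex \<open>v\<close> and fixes all other words.\<close>

definition graft :: "'x list \<Rightarrow> ('x list \<Rightarrow> 'x list) \<Rightarrow> 'x list \<Rightarrow> 'x list" where
  "graft v y w = (if prefix v w then v @ y (drop (length v) w) else w)"

lemma graft_append_arg [simp]: "graft v y (v @ w) = v @ y w"
  by (simp add: graft_def)

lemma graft_graft: "graft u (graft v y) = graft (u @ v) y"
proof
  fix w
  show "graft u (graft v y) w = graft (u @ v) y w"
  proof (cases "prefix u w")
    case True
    then show ?thesis by (auto simp: graft_def prefix_def)
  next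
    case False
    moreover from this have "\<not> prefix (u @ v) w"
      using append_prefixD by blast
    ultimately show ?thesis by (simp add: graft_def)
  qed
qed

lemma graft_True_simps [simp]:
  "graft [True] y [] = []" "graft [True] y (True # w) = True # y w"
  "graft [True] y (False # w) = False # w"
  by (simp_all add: graft_def)

lemma graft_True_cases:
  obtains (Nil) "w = []" | (True) v where "w = True # v" | (False) v where "w = False # v"
  by (cases w; cases "hd w") auto

lemma ginv_graft_True:
  assumes "y \<in> tree_aut"
  shows "ginv (graft [True] y) = graft [True] (ginv y)"
proof (rule inv_unique_comp)
  have "graft [True] y (graft [True] (ginv y) w) = w" "graft [True] (ginv y) (graft [True] y w) = w" for w
    by (cases w rule: graft_True_cases; simp add: tree_aut_inv_cancel assms)+
  then show "graft [True] y \<circ> graft [True] (ginv y) = id" "graft [True] (ginv y) \<circ> graft [True] y = id"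
    by (simp_all add: fun_eq_iff)
qed

text \<open>Two closure properties of normal subgroups, chosen because both are inherited by the set of
  elements whose graft at the vertex $1$ belongs to \<open>K\<close>.\<close>

definition commutator_closed :: "(bool list \<Rightarrow> bool list) set \<Rightarrow> bool" where
  "commutator_closed K \<longleftrightarrow> K \<subseteq> Pi_group \<and>
     (\<forall>k\<in>K. \<forall>g\<in>Pi_group. g \<circ> k \<circ> ginv g \<in> K \<and> k \<circ> g \<circ> ginv k \<circ> ginv g \<in> K)"

definition graft_preimage :: "(bool list \<Rightarrow> bool list) set \<Rightarrow> (bool list \<Rightarrow> bool list) set" where
  "graft_preimage K = {y \<in> Pi_group. graft [True] y \<in> K}"

lemma graft_conj:
  assumes h: "h \<in> Pi_group" "\<And>i. h [i] = [i]"
  shows "h \<circ> graft [True] y \<circ> ginv h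
    = graft [True] (restriction h [True] \<circ> y \<circ> ginv (restriction h [True]))"
proof
  fix w
  have T: "h \<in> tree_aut" "ginv h \<in> tree_aut"
    using h by simp_all
  have hi: "ginv h [i] = [i]" for i
    using h by (simp add: ginv_fix)
  have step: "h (i # v) = i # restriction h [i] v" "ginv h (i # v) = i # restriction (ginv h) [i] v" for i v
    using fixed_letter_Cons[of h i v] fixed_letter_Cons[of "ginv h" i v] T h hi by simp_all
  have inv: "h (ginv h v) = v" for v
    using T by (simp add: tree_aut_inv_cancel)
  show "(h \<circ> graft [True] y \<circ> ginv h) w
    = graft [True] (restriction h [True] \<circ> y \<circ> ginv (restriction h [True])) w"
  proof (cases w rule: graft_True_cases)
    case Nil
    then show ?thesis using tree_autD(3)[OF T(1), of "[]"] tree_autD(3)[OF T(2), of "[]"] by simp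
  next
    case (True v)
    have "restriction (ginv h) [True] = ginv (restriction h [True])"
      using restriction_inv[OF T(1), of "[True]"] hi by simp
    with True show ?thesis by (simp add: step)
  next
    case (False v)
    then show ?thesis using inv[of "False # v"] by (simp add: step)
  qed
qed

lemma graft_commutator:
  assumes h: "h \<in> Pi_group" "\<And>i. h [i] = [i]" and y: "y \<in> Pi_group"
  shows "graft [True] y \<circ> h \<circ> ginv (graft [True] y) \<circ> ginv h
    = graft [True] (y \<circ> restriction h [True] \<circ> ginv y \<circ> ginv (restriction h [True]))"
proof -
  have "graft [True] y \<circ> h \<circ> ginv (graft [True] y) \<circ> ginv h
    = graft [True] y \<circ> (h \<circ> graft [True] (ginv y) \<circ> ginv h)"
    using y by (simp add: ginv_graft_True comp_assoc)
  also have "\<dots> = graft [True] y \<circ>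
      graft [True] (restriction h [True] \<circ> ginv y \<circ> ginv (restriction h [True]))"
    by (simp only: graft_conj[OF h])
  also have "\<dots> = graft [True] (y \<circ> restriction h [True] \<circ> ginv y \<circ> ginv (restriction h [True]))"
  proof
    show "(graft [True] y \<circ> graft [True] (restriction h [True] \<circ> ginv y \<circ> ginv (restriction h [True]))) w
      = graft [True] (y \<circ> restriction h [True] \<circ> ginv y \<circ> ginv (restriction h [True])) w" for w
      by (cases w rule: graft_True_cases) simp_all
  qed
  finally show ?thesis .
qed

lemma commutator_graft:
  assumes k: "k \<in> Pi_group" "\<And>i. k [i] = [i]" and p: "p \<in> Pi_group"
  shows "k \<circ> graft [True] p \<circ> ginv k \<circ> ginv (graft [True] p)
    = graft [True] (restriction k [True] \<circ> p \<circ> ginv (restriction k [True]) \<circ> ginv p)"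
proof -
  have "k \<circ> graft [True] p \<circ> ginv k \<circ> ginv (graft [True] p)
     = graft [True] (restriction k [True] \<circ> p \<circ> ginv (restriction k [True])) \<circ> graft [True] (ginv p)"
    using p graft_conj[OF k] by (simp add: ginv_graft_True)
  also have "\<dots> = graft [True] (restriction k [True] \<circ> p \<circ> ginv (restriction k [True]) \<circ> ginv p)"
  proof
    show "(graft [True] (restriction k [True] \<circ> p \<circ> ginv (restriction k [True])) \<circ> graft [True] (ginv p)) w
      = graft [True] (restriction k [True] \<circ> p \<circ> ginv (restriction k [True]) \<circ> ginv p) w" for w
      by (cases w rule: graft_True_cases) simp_all
  qed
  finally show ?thesis .
qed

lemma aut_d_eq_graft: "aut_of Sd = graft [True] (aut_of Sb)"
proof
  show "aut_of Sd w = graft [True] (aut_of Sb) w" for w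
    by (cases w rule: graft_True_cases) simp_all
qed

text \<open>Conjugating by an element \<open>g\<close> below the vertex $1$ amounts to conjugating the graft by any lift
  of \<open>g\<close> to the stabilizer of the first level.\<close>

lemma commutator_closed_graft_preimage:
  assumes K: "commutator_closed K"
  shows "commutator_closed (graft_preimage K)"
proof -
  have "g \<circ> y \<circ> ginv g \<in> graft_preimage K \<and> y \<circ> g \<circ> ginv y \<circ> ginv g \<in> graft_preimage K"
    if y: "y \<in> graft_preimage K" and g: "g \<in> Pi_group" for y g
  proof -
    obtain h where h: "h \<in> Pi_group" "\<And>i. h [i] = [i]" and hg: "restriction h [True] = g"
      using lift_to_level1_stabilizer[OF g, of True] by (auto simp: level1_stabilizer_def)
    have y': "y \<in> Pi_group" "graft [True] y \<in> K"
      using y by (auto simp: graft_preimage_def)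
    have "h \<circ> graft [True] y \<circ> ginv h \<in> K"
      "graft [True] y \<circ> h \<circ> ginv (graft [True] y) \<circ> ginv h \<in> K"
      using K y'(2) h(1) by (auto simp: commutator_closed_def)
    then show ?thesis
      using y'(1) g unfolding graft_conj[OF h] graft_commutator[OF h y'(1)] hg graft_preimage_def by simp
  qed
  then show ?thesis
    by (auto simp: commutator_closed_def graft_preimage_def)
qed

text \<open>Assume that no non-trivial element of \<open>K\<close> is a graft at the vertex $1$. The commutators of an element \<open>k\<close> of \<open>K\<close>
  fixing the first level with the grafts of the conjugates of $b$ are such grafts, so \<open>k\<close> restricts trivially at
  $1$ and, after conjugation by $a$, at $0$. An element that swaps the letters does not commute with
  $d = (1, b)$, and its commutator with $d$ would fix the first level and yet be non-trivial.\<close>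

lemma graft_preimage_nontrivial:
  assumes K: "commutator_closed K" and nt: "\<not> K \<subseteq> {id}"
  shows "\<not> graft_preimage K \<subseteq> {id}"
proof
  assume triv: "graft_preimage K \<subseteq> {id}"
  have KPi: "k \<in> Pi_group" if "k \<in> K" for k
    using that K by (auto simp: commutator_closed_def)
  have conj: "g \<circ> k \<circ> ginv g \<in> K" and comm: "k \<circ> g \<circ> ginv k \<circ> ginv g \<in> K"
    if "k \<in> K" "g \<in> Pi_group" for k g
    using that K by (auto simp: commutator_closed_def)
  have right: "restriction k [True] w = w" if k: "k \<in> K" "\<And>i. k [i] = [i]" for k w
  proof (rule trivial_if_commutes_with_conjugates)
    let ?k = "restriction k [True]"
    show kPi: "?k \<in> Pi_group" using KPi[OF k(1)] by simp
    have "?k (g (aut_of Sb (ginv g w))) = g (aut_of Sb (ginv g (?k w)))" if g: "g \<in> Pi_group" for g w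
    proof -
      let ?p = "g \<circ> aut_of Sb \<circ> ginv g"
      have p: "?p \<in> Pi_group" using g by simp
      obtain h where h: "h \<in> Pi_group" "\<And>i. h [i] = [i]" "restriction h [True] = g"
        using lift_to_level1_stabilizer[OF g, of True] by (auto simp: level1_stabilizer_def)
      have "h \<circ> aut_of Sd \<circ> ginv h = graft [True] ?p"
        using graft_conj[OF h(1,2)] h(3) by (simp only: aut_d_eq_graft)
      moreover have "h \<circ> aut_of Sd \<circ> ginv h \<in> Pi_group"
        using h(1) by simp
      ultimately have "graft [True] ?p \<in> Pi_group"
        by (simp only:)
      then have "graft [True] (?k \<circ> ?p \<circ> ginv ?k \<circ> ginv ?p) \<in> K"
        using comm[OF k(1)] commutator_graft[OF KPi[OF k(1)] k(2) p] by metis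
      moreover have "?k \<circ> ?p \<circ> ginv ?k \<circ> ginv ?p \<in> Pi_group"
        using kPi p by simp
      ultimately have "?k \<circ> ?p \<circ> ginv ?k \<circ> ginv ?p = id"
        using triv by (auto simp: graft_preimage_def)
      then have "?k (?p (ginv ?k (ginv ?p z))) = z" for z
        by (metis comp_apply id_apply)
      from this[of "?p (?k w)"] have "?k (?p w) = ?p (?k w)"
        using tree_aut_inv_cancel(2)[of ?p] tree_aut_inv_cancel(2)[of ?k] p kPi by simp
      then show ?thesis by simp
    qed
    then show "\<exists>q\<in>{Sa, Sb, Sd}. commutes_with_conjugates ?k (aut_of q)"
      unfolding commutes_with_conjugates_def by blast
  qed
  have stab: "k w = w" if k: "k \<in> K" "\<And>i. k [i] = [i]" for k w
  proof -
    let ?a = "aut_of Sa"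
    have T: "k \<in> tree_aut" using KPi[OF k(1)] by simp
    note k_Cons = fixed_letter_Cons[OF T k(2)]
    let ?m = "ginv ?a \<circ> k \<circ> ginv (ginv ?a)"
    have "?m \<in> K"
      using conj[OF k(1), of "ginv ?a"] by simp
    moreover have "?m [i] = [i]" for i
      by (cases i) (simp_all add: k(2))
    moreover have "restriction ?m [True] = restriction k [False]"
      by (rule restriction_eqI[where u = "[True]"]) (simp_all add: k_Cons inv_id)
    ultimately have left: "restriction k [False] v = v" for v
      using right[of ?m v] by simp
    show ?thesis
    proof (cases w rule: graft_True_cases)
      case Nil
      then show ?thesis using tree_autD(3)[OF T, of "[]"] by simp
    qed (simp_all add: k_Cons left right[OF k])
  qed
  obtain k where k: "k \<in> K" "k \<noteq> id"
    using nt by blast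
  have T: "k \<in> tree_aut" "ginv k \<in> tree_aut" using KPi[OF k(1)] by simp_all
  have "\<exists>i. k [i] \<noteq> [i]"
    using stab[OF k(1)] k(2) by auto
  moreover have "k [True] \<noteq> k [False]"
    using injD[OF tree_autD(2)[OF T(1)], of "[True]" "[False]"] by auto
  moreover have "\<exists>j. k [i] = [j]" for i
    using tree_autD(3)[OF T(1), of "[i]"] by (cases "k [i]") auto
  ultimately have swap: "k [i] = [\<not> i]" for i
    by (metis (full_types))
  have swap': "ginv k [i] = [\<not> i]" for i
    using swap[of "\<not> i"] tree_aut_inv_cancel(2)[OF T(1), of "[\<not> i]"] by simp
  let ?d = "aut_of Sd"
  have "(k \<circ> ?d \<circ> ginv k \<circ> ginv ?d) [i] = [i]" for i
    by (cases i) (simp_all add: swap swap')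
  then have "(k \<circ> ?d \<circ> ginv k \<circ> ginv ?d) w = w" for w
    by (rule stab[OF comm[OF k(1) aut_of_in_Pi_group]])
  then have *: "k (?d (ginv k (ginv ?d w))) = w" for w
    by (metis comp_apply)
  (* d moves 100 to 101, whereas its conjugate by k acts below 0 only. *)
  let ?w = "True # [False, False]"
  have "ginv k ?w = False # restriction (ginv k) [True] [False, False]"
    using tree_aut_Cons[OF T(2), of True "[False, False]"] swap'[of True] by simp
  then have "k (?d (ginv k ?w)) = ?w"
    using tree_aut_inv_cancel(1)[OF T(1), of ?w] by simp
  then have "?d ?w = ?w"
    using *[of "?d ?w"] by simp
  then show False by simp
qed

lemma graft_in_Pi_group_nontrivial: "\<exists>y. y \<noteq> id \<and> graft (replicate n True) y \<in> Pi_group"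
proof -
  have "\<exists>K. commutator_closed K \<and> \<not> K \<subseteq> {id} \<and> (\<forall>y\<in>K. graft (replicate n True) y \<in> Pi_group)"
  proof (induction n)
    case 0
    have "aut_of Sa [True] \<noteq> id [True]" by simp
    then have "\<not> Pi_group \<subseteq> {id}"
      by (metis aut_of_in_Pi_group singletonD subsetD)
    moreover have "commutator_closed Pi_group"
      by (simp add: commutator_closed_def)
    moreover have "graft (replicate 0 True) y = y" for y
      by (rule ext) (simp add: graft_def)
    then have "\<forall>y\<in>Pi_group. graft (replicate 0 True) y \<in> Pi_group"
      by (simp only:) simp
    ultimately show ?case by blast
  next
    case (Suc n)
    then obtain K where K: "commutator_closed K" "\<not> K \<subseteq> {id}"
      "\<forall>y\<in>K. graft (replicate n True) y \<in> Pi_group"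
      by blast
    have "graft (replicate (Suc n) True) y \<in> Pi_group" if "y \<in> graft_preimage K" for y
    proof -
      have "graft (replicate n True) (graft [True] y) \<in> Pi_group"
        using K(3) that by (simp add: graft_preimage_def)
      then show ?thesis
        by (simp only: graft_graft replicate_append_same replicate_Suc)
    qed
    then show ?case
      using commutator_closed_graft_preimage[OF K(1)] graft_preimage_nontrivial[OF K(1,2)] by blast
  qed
  then show ?thesis by blast
qed

lemma rigid_stabilizer_True_nontrivial:
  "\<exists>g\<in>rigid_stabilizer Pi_group (replicate n True). g \<noteq> id"
proof -
  let ?v = "replicate n True"
  obtain y where y: "y \<noteq> id" "graft ?v y \<in> Pi_group"
    using graft_in_Pi_group_nontrivial by blast
  obtain u where "y u \<noteq> u"
    using y(1) by (auto simp: fun_eq_iff)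
  then have "graft ?v y (?v @ u) \<noteq> id (?v @ u)" by simp
  then have "graft ?v y \<noteq> id" by metis
  moreover have "graft ?v y \<in> rigid_stabilizer Pi_group ?v"
    using y(2) by (simp add: rigid_stabilizer_def graft_def)
  ultimately show ?thesis by blast
qed

text \<open>If the rigid stabilizer were finite, a single bound would exist below which each non-trivial element
  moves a word. A non-trivial element of the rigid stabilizer of a deeper vertex $1^m$ belongs to it as well, yet it moves only
  words of length at least \<open>m\<close>.\<close>

lemma infinite_rigid_stabilizer: "infinite (rigid_stabilizer Pi_group (replicate n True))"
proof
  let ?R = "\<lambda>m. rigid_stabilizer Pi_group (replicate m True)"
  assume fin: "finite (?R n)"
  have "\<exists>w. g w \<noteq> w" if "g \<noteq> id" for g :: "bool list \<Rightarrow> bool list"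
    using that by (auto simp: fun_eq_iff)
  then obtain moved where moved: "\<And>g :: bool list \<Rightarrow> bool list. g \<noteq> id \<Longrightarrow> g (moved g) \<noteq> moved g"
    by metis
  let ?L = "(length \<circ> moved) ` ?R n"
  define m where "m = n + Suc (Max ?L)"
  obtain g where g: "g \<in> ?R m" "g \<noteq> id"
    using rigid_stabilizer_True_nontrivial by blast
  have "prefix (replicate n True) w" if "prefix (replicate m True) w" for w
    using that append_prefixD unfolding m_def replicate_add by blast
  then have "g \<in> ?R n"
    using g(1) by (auto simp: rigid_stabilizer_def)
  then have "length (moved g) \<le> Max ?L"
    using fin by (intro Max_ge) auto
  then have "length (moved g) < length (replicate m True)"
    by (simp add: m_def)
  then have "\<not> prefix (replicate m True) (moved g)"
    using prefix_length_le by fastforce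
  then show False
    using g moved by (auto simp: rigid_stabilizer_def)
qed

lemma weakly_branch_Pi_group: "weakly_branch Pi_group"
  unfolding weakly_branch_def
proof (intro conjI allI impI subgroup_Pi_group)
  show "level_transitive Pi_group"
    using fractal_Pi_group by (simp add: fractal_def)
  fix n :: nat
  have "rigid_stabilizer Pi_group (replicate n True) \<subseteq> rigid_level_stabilizer Pi_group n"
    unfolding rigid_level_stabilizer_def
    by (intro subsetI generate.incl UN_I[of "replicate n True"]) simp_all
  then show "infinite (rigid_level_stabilizer Pi_group n)"
    using infinite_rigid_stabilizer finite_subset by blast
qed

section \<open>Activity\<close>

lemma restriction_act_Cons: "restriction (act M q) (x # v) = restriction (act M (next_state M q x)) v"
  by (auto simp: restriction_def)

lemma activity_Suc:
  fixes M :: "('q, bool) automaton"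
  shows "activity M q (Suc n) = activity M (next_state M q False) n + activity M (next_state M q True) n"
proof -
  let ?A = "\<lambda>q n. {v. length v = n \<and> restriction (act M q) v \<noteq> id}"
  have fin: "finite (?A q n)" for q n
    by (rule finite_subset[OF _ finite_lists_length_eq[of "UNIV :: bool set" n]]) auto
  have "?A q (Suc n) = (#) False ` ?A (next_state M q False) n \<union> (#) True ` ?A (next_state M q True) n"
  proof (rule Set.set_eqI)
    fix v
    show "v \<in> ?A q (Suc n) \<longleftrightarrow>
      v \<in> (#) False ` ?A (next_state M q False) n \<union> (#) True ` ?A (next_state M q True) n"
      by (cases v; cases "hd v") (auto simp: restriction_act_Cons)
  qed
  moreover have "card ((#) False ` ?A (next_state M q False) n \<union> (#) True ` ?A (next_state M q True) n)
    = card ((#) False ` ?A (next_state M q False) n) + card ((#) True ` ?A (next_state M q True) n)"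
    using fin by (intro card_Un_disjoint finite_imageI) auto
  ultimately show ?thesis
    unfolding activity_def by (simp only:) (simp add: card_image)
qed

lemma activity_0: "activity M q 0 = (if act M q = id then 0 else 1)"
proof -
  have "{v. length v = 0 \<and> restriction (act M q) v \<noteq> id} = (if act M q = id then {} else {[]})"
    by auto
  then show ?thesis
    by (simp add: activity_def)
qed

text \<open>The path $a \to d \to b \to \{a, c\}$, $c \to \{a, a\}$ of active states yields
  $A_{n+4} = A_{n+1} + 2A_n$.\<close>

lemma exponential_activity_Pi_automaton: "exponential_activity Pi_automaton"
proof -
  let ?A = "activity Pi_automaton"
  have S1: "?A S1 n = 0" for n
    by (induction n) (simp_all add: activity_0 activity_Suc)
  have nontrivial: "aut_of q \<noteq> id" if "q \<noteq> S1" for q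
  proof -
    (* One word that all four generators move. *)
    have "aut_of q [True, False, False] \<noteq> id [True, False, False]"
      using that by (cases q) simp_all
    then show ?thesis by metis
  qed
  have rec: "?A Sa (Suc n) = ?A Sd n" "?A Sd (Suc n) = ?A Sb n"
    "?A Sb (Suc n) = ?A Sa n + ?A Sc n" "?A Sc (Suc n) = 2 * ?A Sa n" for n
    by (simp_all add: activity_Suc S1)
  have init: "?A q 0 = 1" if "q \<noteq> S1" for q
    using nontrivial[OF that] by (simp add: activity_0)
  have "?A Sa n \<ge> 1/4 * (4/3) ^ n" for n
  proof (induction n rule: less_induct)
    case (less n)
    consider "n = 0" | "n = Suc 0" | "n = Suc (Suc 0)" | "n = Suc (Suc (Suc 0))"
      | m where "n = Suc (Suc (Suc (Suc m)))"
      by (metis not0_implies_Suc)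
    then show ?case
    proof cases
      case 5
      have "1/4 * (4/3::real) ^ n = 256/81 * (1/4 * (4/3) ^ m)"
        by (simp add: 5)
      also have "\<dots> \<le> 1/4 * (4/3) ^ Suc m + 2 * (1/4 * (4/3) ^ m)"
        by simp
      also have "\<dots> \<le> ?A Sa (Suc m) + 2 * ?A Sa m"
        using less.IH[of m] less.IH[of "Suc m"] by (simp add: 5)
      also have "\<dots> = ?A Sa n"
        by (simp only: 5 rec)
      finally show ?thesis .
    qed (simp_all add: rec init)
  qed
  then show ?thesis
    unfolding exponential_activity_def
    by (intro exI[of _ Sa] exI[of _ "1/4"] exI[of _ "4/3"] conjI) simp_all
qed

theorem theorem1p1:
  shows "(contracting Pi_group \<and> (\<exists>N. is_nucleus Pi_group N \<and> N \<noteq> {})) \<and>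
         fractal Pi_group \<and>
         open_set_condition Pi_group \<and>
         exponential_activity Pi_automaton \<and>
         weakly_branch Pi_group"
proof -
  obtain N where "is_nucleus Pi_group N"
    using contracting_ex1_nucleus[OF contracting_Pi_group] by blast
  moreover from this have "N \<noteq> {}"
    using absorbing_nonempty[of Pi_group N] Pi_group_id unfolding is_nucleus_def by blast
  ultimately show ?thesis
    using contracting_Pi_group fractal_Pi_group open_set_condition_Pi_group
      exponential_activity_Pi_automaton weakly_branch_Pi_group by blast
qed

end
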